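(* Let $R$ be a local principal ideal ring of length two. For all $n\geq 3$, there exist matrices $\mathbf A\in M_n(R)$ which are not similar to their transposes.
   Context: $R$ is commutative. Two matrices in $M_n(R)$ are similar if they are conjugate under $\mathrm{GL}_n(R)$. *)

theory Defs
  imports
    "Jordan_Normal_Form.Matrix"
    "HOL-Algebra.Algebraic_Closure_Type"
    "HOL-Library.Extended_Nat"
begin

definition local_ring :: "('a, 'b) ring_scheme \<Rightarrow> bool" where
  "local_ring R \<longleftrightarrow> cring R \<and> (\<exists>!M. maximalideal M R)"

text \<open>Zero divisors are allowed, unlike in \<^locale>\<open>principal_domain\<close>.\<close>

definition principal_ideal_ring :: "('a, 'b) ring_scheme \<Rightarrow> bool" where
  "principal_ideal_ring R \<longleftrightarrow> cring R \<and> (\<forall>I. ideal I R \<longrightarrow> principalideal I R)"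

text \<open>The length of a commutative ring as a module over itself, whose submodules are the
  ideals: the supremum of the lengths of strict chains
  \<open>I 0 \<subset> I 1 \<subset> \<dots> \<subset> I k\<close> of ideals, where \<open>k\<close> counts the inclusions.\<close>

definition ring_length :: "('a, 'b) ring_scheme \<Rightarrow> enat" where
  "ring_length R = Sup {enat k | k. \<exists>I :: nat \<Rightarrow> 'a set.
     (\<forall>i\<le>k. ideal (I i) R) \<and> (\<forall>i<k. I i \<subset> I (Suc i))}"

end

theory Submission
  imports Defs
begin

text \<open>
  A local ring of length two contains some \<open>t \<noteq> 0\<close> with \<open>t\<^sup>2 = 0\<close>: any nonzero element of its
  maximal ideal will do. Over any commutative ring with such a \<open>t\<close>, let \<open>A\<close> be the matrix with
  \<open>e\<^sub>1 \<mapsto> e\<^sub>0 \<mapsto> t e\<^sub>2\<close> that sends every other basis vector to zero.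
  Modulo \<open>t\<close> it is a nilpotent Jordan block of size two, \<open>e\<^sub>1 \<mapsto> e\<^sub>0 \<mapsto> 0\<close>, padded by
  zeros, and so is similar to its transpose; the perturbation by \<open>t\<close> breaks the symmetry, since
  it leads out of the block into the padding for \<open>A\<close>, but from the padding into the block for
  the transpose.

  An invariant that detects the difference is whether the image of \<open>X\<^sup>2\<close> lies in \<open>t\<close> times
  the image of \<open>X\<close>, that is, whether \<open>X\<^sup>2 = t X C\<close> for some \<open>C\<close>; it is invariant under similarity
  by \<open>similar_mat_square_factors\<close>. The image of \<open>A\<^sup>2\<close> is spanned by \<open>t e\<^sub>2\<close>, whereas the image of
  \<open>A\<close> is spanned by \<open>e\<^sub>0\<close> and \<open>t e\<^sub>2\<close>, so \<open>t\<close> times it is spanned by \<open>t e\<^sub>0\<close>. For the transpose,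
  \<open>e\<^sub>2 \<mapsto> t e\<^sub>0 \<mapsto> t e\<^sub>1\<close>, so its square has image spanned by \<open>t e\<^sub>1\<close>; this is \<open>t\<close> times
  the image of \<open>e\<^sub>0\<close>.
\<close>

lemma strict_ideal_chain_le_ring_length:
  assumes "\<And>i. i \<le> k \<Longrightarrow> ideal (I i) R" and "\<And>i. i < k \<Longrightarrow> I i \<subset> I (Suc i)"
  shows "enat k \<le> ring_length R"
  unfolding ring_length_def by (rule Sup_upper) (use assms in blast)

lemma (in ring) nonzero_proper_ideal_maximal_if_length_2:
  assumes len: "ring_length R = 2"
    and I: "ideal I R" "I \<noteq> {\<zero>}" "I \<noteq> carrier R"
  shows "maximalideal I R"
proof (rule maximalidealI)
  show "ideal I R" "carrier R \<noteq> I" using I by auto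
  fix J assume J: "ideal J R" "I \<subseteq> J" "J \<subseteq> carrier R"
  show "J = I \<or> J = carrier R"
  proof (rule ccontr)
    assume "\<not> (J = I \<or> J = carrier R)"
    \<comment> \<open>Then \<open>0 \<subset> I \<subset> J \<subset> R\<close> would be a chain with three inclusions.\<close>
    then have "I \<subset> J" "J \<subset> carrier R" using J by auto
    moreover have "{\<zero>} \<subset> I"
      using I additive_subgroup.zero_closed[OF ideal.axioms(1)] by blast
    moreover define F where "F = (\<lambda>i. [{\<zero>}, I, J, carrier R] ! i)"
    ultimately have "enat 3 \<le> ring_length R"
      using I J zeroideal oneideal
      by (intro strict_ideal_chain_le_ring_length[of _ F])
        (auto simp: F_def less_Suc_eq le_Suc_eq numeral_3_eq_3)
    then show False using len by (simp add: numeral_eq_enat)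
  qed
qed

lemma (in ring) nonzero_proper_ideal_exists_if_length_2:
  assumes "ring_length R = 2"
  obtains I where "ideal I R" "I \<noteq> {\<zero>}" "I \<noteq> carrier R"
proof -
  have "enat 1 < ring_length R" using assms by (simp add: numeral_eq_enat)
  then obtain k I where "enat 1 < enat k"
    and I: "\<forall>i\<le>k. ideal (I i) R" "\<forall>i<k. I i \<subset> I (Suc i)"
    unfolding ring_length_def less_Sup_iff by blast
  then have k: "1 < k" by simp
  have "ideal (I 0) R" "ideal (I 1) R" "ideal (I 2) R" "I 0 \<subset> I 1" "I 1 \<subset> I 2"
    using k I(1)[rule_format, of 0] I(1)[rule_format, of 1] I(1)[rule_format, of 2]
      I(2)[rule_format, of 0] I(2)[rule_format, of 1]
    by (auto simp: numeral_2_eq_2)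
  moreover have "\<zero> \<in> I 0" "I 2 \<subseteq> carrier R"
    using calculation additive_subgroup.zero_closed ideal.axioms(1)
      additive_subgroup.a_subset by blast+
  ultimately show thesis by (intro that[of "I 1"]) auto
qed

text \<open>
  In length two every nonzero proper ideal is maximal, so locality leaves just one of them, \<open>M\<close>.
  If \<open>t \<in> M\<close> had a nonzero square, then \<open>t\<^sup>2\<close> would generate \<open>M\<close> as well, whence
  \<open>t = r t\<^sup>2\<close>; but \<open>1 - r t\<close> lies outside \<open>M\<close> and is therefore a unit, which kills \<open>t\<close>.
\<close>

lemma nonzero_square_zero_exists_if_local_length_2:
  fixes R (structure)
  assumes loc: "local_ring R" and len: "ring_length R = 2"
  obtains t where "t \<in> carrier R" "t \<noteq> \<zero>" "t \<otimes> t = \<zero>"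
proof -
  interpret cring R using loc by (simp add: local_ring_def)
  obtain M where M: "ideal M R" "M \<noteq> {\<zero>}" "M \<noteq> carrier R"
    using nonzero_proper_ideal_exists_if_length_2[OF len] .
  interpret M: ideal M R by (rule M)
  have only: "J = M" if "ideal J R" "J \<noteq> {\<zero>}" "J \<noteq> carrier R" for J
    using loc nonzero_proper_ideal_maximal_if_length_2[OF len] M that
    unfolding local_ring_def by blast
  obtain t where t: "t \<in> M" "t \<noteq> \<zero>" using M M.zero_closed by blast
  have tR: "t \<in> carrier R" using t M.a_subset by blast
  have "t \<otimes> t = \<zero>"
  proof (rule ccontr)
    assume nz: "t \<otimes> t \<noteq> \<zero>"
    have tt: "t \<otimes> t \<in> M" using t tR by (simp add: M.I_l_closed)
    have "PIdl (t \<otimes> t) = M"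
    proof (rule only)
      show "PIdl (t \<otimes> t) \<noteq> {\<zero>}" using cgenideal_self[of "t \<otimes> t"] nz tR by auto
      show "PIdl (t \<otimes> t) \<noteq> carrier R"
        using cgenideal_minimal[OF M(1) tt] M M.a_subset by blast
    qed (use tR in \<open>auto intro: cgenideal_ideal\<close>)
    with t obtain r where r: "r \<in> carrier R" "t = r \<otimes> (t \<otimes> t)"
      unfolding cgenideal_def by blast
    define u where "u = \<one> \<ominus> r \<otimes> t"
    have uR: "u \<in> carrier R" using r tR by (simp add: u_def)
    have rtM: "r \<otimes> t \<in> M" using t r by (simp add: M.I_l_closed)
    have uM: "u \<notin> M"
    proof
      assume "u \<in> M"
      then have "u \<oplus> r \<otimes> t \<in> M" using rtM by (rule M.a_closed)
      moreover have "u \<oplus> r \<otimes> t = \<one>" unfolding u_def using r(1) tR by algebra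
      ultimately show False using M.one_imp_carrier M by simp
    qed
    have "PIdl u = carrier R"
    proof (rule ccontr)
      assume "PIdl u \<noteq> carrier R"
      moreover have "PIdl u \<noteq> {\<zero>}"
        using cgenideal_self[OF uR] uM M.zero_closed by auto
      ultimately have "PIdl u = M" by (intro only cgenideal_ideal uR)
      then show False using cgenideal_self[OF uR] uM by simp
    qed
    then obtain v where v: "v \<in> carrier R" "\<one> = v \<otimes> u"
      unfolding cgenideal_def by blast
    have "u \<otimes> t = t \<ominus> r \<otimes> (t \<otimes> t)" unfolding u_def using r(1) tR by algebra
    then have "u \<otimes> t = \<zero>" using r(2) tR by (simp add: a_minus_def r_neg)
    then have "v \<otimes> u \<otimes> t = \<zero>" using v(1) uR tR by (simp add: m_assoc)
    then show False using v(2)[symmetric] t tR by simp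
  qed
  then show thesis using that t tR by blast
qed

text \<open>
  The factor \<open>C\<close> may be arbitrary, so conjugating it along with \<open>B\<close> turns a factorization for
  \<open>B\<close> into one for \<open>A\<close>.
\<close>

lemma similar_mat_square_factors:
  fixes A B C :: "'a :: comm_ring_1 mat"
  assumes sim: "similar_mat A B" and B: "B \<in> carrier_mat n n" and C: "C \<in> carrier_mat n n"
    and BB: "B * B = t \<cdot>\<^sub>m (B * C)"
  obtains D where "D \<in> carrier_mat n n" "A * A = t \<cdot>\<^sub>m (A * D)"
proof -
  obtain m P Q where "{A, B, P, Q} \<subseteq> carrier_mat m m"
    and "Q * P = 1\<^sub>m m" and A: "A = P * B * Q"
    using similar_matD[OF sim] by blast
  moreover from this have "m = n" using B by auto
  ultimately have P: "P \<in> carrier_mat n n" and Q: "Q \<in> carrier_mat n n"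
    and QP: "Q * P = 1\<^sub>m n" by auto
  have conj_mult: "(P * V * Q) * (P * W * Q) = P * (V * W) * Q"
    if V: "V \<in> carrier_mat n n" and W: "W \<in> carrier_mat n n" for V W
  proof -
    have "(P * V * Q) * (P * W * Q) = P * V * (Q * P) * W * Q"
      using P Q V W by (simp add: assoc_mult_mat[of _ n n _ n _ n])
    also have "\<dots> = P * (V * W) * Q" unfolding QP using P Q V W
      by (simp add: assoc_mult_mat[of _ n n _ n _ n])
    finally show ?thesis .
  qed
  have "A * A = P * (t \<cdot>\<^sub>m (B * C)) * Q" unfolding A conj_mult[OF B B] BB ..
  also have "\<dots> = t \<cdot>\<^sub>m (P * (B * C) * Q)"
    using P Q B C
    by (metis mult_carrier_mat mult_smult_assoc_mat mult_smult_distrib)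
  also have "\<dots> = t \<cdot>\<^sub>m (A * (P * C * Q))" unfolding A conj_mult[OF B C] ..
  finally show thesis using that P Q C by (metis mult_carrier_mat)
qed

lemma not_similar_transpose_exists:
  fixes t :: "'a :: comm_ring_1"
  assumes t: "t \<noteq> 0" "t * t = 0" and n: "n \<ge> 3"
  shows "\<exists>A :: 'a mat. A \<in> carrier_mat n n \<and> \<not> similar_mat A (transpose_mat A)"
proof -
  define A where "A = mat n n (\<lambda>(i, j).
    if i = 0 \<and> j = 1 then 1 else if i = 2 \<and> j = 0 then t else 0)"
  have A: "A \<in> carrier_mat n n" by (simp add: A_def)
  have not_factors: "A * A \<noteq> t \<cdot>\<^sub>m (A * D)" if D: "D \<in> carrier_mat n n" for D
  proof
    \<comment> \<open>Entry \<open>(2, 1)\<close> is \<open>t\<close> on the left, but a multiple of \<open>t\<^sup>2 = 0\<close> on the right,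
      because row \<open>2\<close> of \<open>A\<close> is itself divisible by \<open>t\<close>.\<close>
    assume eq: "A * A = t \<cdot>\<^sub>m (A * D)"
    have row: "row A 2 $ k = (if k = 0 then t else 0)" if "k < n" for k
      using n that by (auto simp: A_def)
    have entry: "(A * V) $$ (2, 1) = t * V $$ (0, 1)" if "V \<in> carrier_mat n n" for V
    proof -
      have "(A * V) $$ (2, 1) = (\<Sum>k = 0..<n. row A 2 $ k * V $$ (k, 1))"
        using n A that by (simp add: scalar_prod_def)
      also have "\<dots> = (\<Sum>k = 0..<n. if k = 0 then t * V $$ (k, 1) else 0)"
        by (rule sum.cong) (simp_all add: row)
      finally show ?thesis using n by simp
    qed
    have "t = (A * A) $$ (2, 1)" using n entry[OF A] by (simp add: A_def)
    also have "\<dots> = t * (t * D $$ (0, 1))"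
      unfolding eq using n A D entry[OF D] by simp
    finally show False using t by (simp flip: mult.assoc)
  qed
  \<comment> \<open>The square of the transpose sends \<open>e\<^sub>2\<close> to \<open>t e\<^sub>1\<close> and the other basis vectors to \<open>0\<close>.
    As \<open>e\<^sub>1\<close> is the image of \<open>e\<^sub>0\<close>, take for \<open>C\<close> the matrix unit \<open>e\<^sub>2 \<mapsto> e\<^sub>0\<close>.\<close>
  define C :: "'a mat" where "C = mat n n (\<lambda>(i, j). if i = 0 \<and> j = 2 then 1 else 0)"
  have C: "C \<in> carrier_mat n n" by (simp add: C_def)
  have entry: "(transpose_mat A * V) $$ (i, j) =
      (if i = 1 then V $$ (0, j) else if i = 0 then t * V $$ (2, j) else 0)"
    if V: "V \<in> carrier_mat n n" and ij: "i < n" "j < n" for V i j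
  proof -
    have "(transpose_mat A * V) $$ (i, j) = (\<Sum>k = 0..<n. A $$ (k, i) * V $$ (k, j))"
      using A V ij by (simp add: scalar_prod_def)
    also have "\<dots> = (\<Sum>k = 0..<n. if k = (if i = 1 then 0 else 2)
        then (if i = 1 then V $$ (0, j) else if i = 0 then t * V $$ (2, j) else 0) else 0)"
      by (rule sum.cong) (use ij in \<open>auto simp: A_def\<close>)
    finally show ?thesis using n by simp
  qed
  have "transpose_mat A * transpose_mat A = t \<cdot>\<^sub>m (transpose_mat A * C)"
  proof (rule eq_matI)
    fix i j assume "i < dim_row (t \<cdot>\<^sub>m (transpose_mat A * C))"
      "j < dim_col (t \<cdot>\<^sub>m (transpose_mat A * C))"
    then have ij: "i < n" "j < n" using A C by auto
    have "(transpose_mat A * transpose_mat A) $$ (i, j) = t * (transpose_mat A * C) $$ (i, j)"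
      using entry[OF _ ij, of "transpose_mat A"] entry[OF C ij] A ij n
      by (auto simp: A_def C_def)
    then show "(transpose_mat A * transpose_mat A) $$ (i, j) =
        (t \<cdot>\<^sub>m (transpose_mat A * C)) $$ (i, j)" using A C ij by simp
  qed (use A C in auto)
  then have "\<not> similar_mat A (transpose_mat A)"
    using similar_mat_square_factors[of A "transpose_mat A" n C t] not_factors A C
    by (metis transpose_carrier_mat)
  with A show ?thesis by blast
qed

theorem theorem7p9:
  fixes n :: nat
  assumes "local_ring (ring_of_type_algebra :: 'a :: comm_ring_1 ring)"
    and "principal_ideal_ring (ring_of_type_algebra :: 'a ring)"
    and "ring_length (ring_of_type_algebra :: 'a ring) = 2"
    and "n \<ge> 3"
  shows "\<exists>A :: 'a mat. A \<in> carrier_mat n n \<and> \<not> similar_mat A (transpose_mat A)"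
proof -
  obtain t :: 'a where "t \<noteq> 0" "t * t = 0"
    using nonzero_square_zero_exists_if_local_length_2[OF assms(1,3)]
    by (auto simp: ring_of_type_algebra_def)
  then show ?thesis using assms(4) by (rule not_similar_transpose_exists)
qed

end
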